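(* As $x\to\infty$, \[M_{\mathrm{id},2,2}(x)= \frac{\zeta(3)}{\zeta(4)}x^2+O(x\log x).\] Moreover, for all fixed integers $b\geq 3$ and $k\ge 2$, as $x\to\infty$, \[M_{\mathrm{id},b,k}(x)=\frac{\zeta(bk-1)}{\zeta(bk)}x^k+O_b\left(x^{k-1}\right).\]
   Context: For integers $b\ge 2$, $k\ge 2$ and positive integers $n_1,\dots,n_k$, the generalized gcd is $(n_1,\dots,n_k)_b:=\max\{d\ge 1: d^b\mid n_1,\dots,d^b\mid n_k\}$. For an arithmetic function $f$, $M_{f,b,k}(x):=\sum_{n_1,\dots,n_k\le x}f((n_1,\dots,n_k)_b)$, the sum running over all $k$-tuples of positive integers at most $x$; $\mathrm{id}$ denotes the identity function $\mathrm{id}(n)=n$, so $M_{\mathrm{id},b,k}(x)=\sum_{n_1,\dots,n_k\le x}(n_1,\dots,n_k)_b$. Here $\zeta$ is the Riemann zeta function and $x$ is a real variable. The integer $k$ is fixed (the implied constant may depend on $k$ as well as on $b$). *)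

theory Defs
  imports Complex_Main "HOL-Library.FuncSet" "HOL-Library.Landau_Symbols"
begin

text \<open>A \<open>k\<close>-tuple \<open>(n\<^sub>1, \<dots>, n\<^sub>k)\<close> is represented by a function on the index set \<open>{..<k}\<close>.\<close>

definition gen_gcd :: "nat \<Rightarrow> nat \<Rightarrow> (nat \<Rightarrow> nat) \<Rightarrow> nat" where
  "gen_gcd b k n = Max {d. d \<ge> 1 \<and> (\<forall>i<k. d ^ b dvd n i)}"

text \<open>The maximum is taken over a finite nonempty set as soon as the entries are positive.\<close>

lemma
  fixes b k :: nat and n :: "nat \<Rightarrow> nat"
  assumes "b \<ge> 1" "k \<ge> 1" "\<And>i. i < k \<Longrightarrow> n i > 0"
  shows finite_gen_gcd_set: "finite {d. d \<ge> 1 \<and> (\<forall>i<k. d ^ b dvd n i)}"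
    and gen_gcd_set_nonempty: "{d. d \<ge> 1 \<and> (\<forall>i<k. d ^ b dvd n i)} \<noteq> {}"
proof -
  let ?S = "{d. d \<ge> 1 \<and> (\<forall>i<k. d ^ b dvd n i)}"
  have "?S \<subseteq> {..n 0}"
  proof
    fix d assume "d \<in> ?S"
    then have d: "1 \<le> d" "d ^ b dvd n 0"
      using assms(2) by auto
    have "d \<le> d ^ b"
      by (rule self_le_power) (use d assms(1) in linarith)+
    also have "d ^ b \<le> n 0"
      by (rule dvd_imp_le[OF d(2) assms(3)]) (use assms(2) in linarith)
    finally show "d \<in> {..n 0}"
      by simp
  qed
  then show "finite ?S"
    by (rule finite_subset) simp
  have "1 \<in> ?S"
    by simp
  then show "?S \<noteq> {}"
    by blast
qed

text \<open>
  The extensional function space \<open>\<rightarrow>\<^sub>E\<close> makes each tuple correspond to exactly one function,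
  so that no tuple is counted more than once.
\<close>

definition gcd_sum :: "(nat \<Rightarrow> 'a :: comm_monoid_add) \<Rightarrow> nat \<Rightarrow> nat \<Rightarrow> real \<Rightarrow> 'a" where
  "gcd_sum f b k x =
     (\<Sum>n \<in> {..<k} \<rightarrow>\<^sub>E {m :: nat. 1 \<le> m \<and> real m \<le> x}. f (gen_gcd b k n))"

text \<open>The Riemann zeta function on the half-line \<open>s > 1\<close> of convergence of its Dirichlet series.\<close>

definition zeta :: "real \<Rightarrow> real" where
  "zeta s = (\<Sum>n. 1 / real (Suc n) powr s)"

end

theory Submission
  imports Defs "HOL-Number_Theory.Totient" "HOL-Analysis.Harmonic_Numbers"
    "HOL-Analysis.Infinite_Sum"
begin

text \<open>
  Write \<open>d\<close> as the sum of \<open>\<phi>(e)\<close> over the divisors \<open>e\<close> of \<open>d\<close>. Since \<open>e\<close> divides the generalized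
  gcd iff \<open>e\<^sup>b\<close> divides every entry of the tuple, the sum in question equals
  \<open>\<Sum>\<^sub>e \<phi>(e) \<lfloor>x / e\<^sup>b\<rfloor>\<^sup>k\<close>, where only \<open>e \<le> x\<close> contribute. Replacing \<open>\<lfloor>y\<rfloor>\<^sup>k\<close> by \<open>y\<^sup>k\<close> costs at most
  \<open>k y\<^sup>k\<^sup>-\<^sup>1\<close>, and the complete series \<open>\<Sum>\<^sub>e \<phi>(e) / e\<^sup>b\<^sup>k\<close> is \<open>\<zeta>(bk - 1) / \<zeta>(bk)\<close>. Both the total cost of
  removing the floors and the tail of the series over \<open>e > x\<close> are estimated using \<open>\<phi>(e) \<le> e\<close>.
\<close>

section \<open>Divisors of the generalized gcd\<close>

lemma lcm_power_nat: "lcm (a ^ b) (c ^ b) = lcm a c ^ b" for a b c :: nat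
proof (cases "a = 0 \<or> c = 0")
  case True
  then show ?thesis by (cases "b = 0") auto
next
  case False
  \<comment> \<open>Both sides equal \<open>a ^ b * c ^ b\<close>, since gcd commutes with powers;
    the gcd factor is then cancelled.\<close>
  have "lcm (a ^ b) (c ^ b) * gcd a c ^ b = lcm a c ^ b * gcd a c ^ b"
    by (metis gcd_exp lcm_mult_gcd normalize_nat_def id_apply power_mult_distrib)
  moreover have "gcd a c ^ b \<noteq> 0"
    using False by simp
  ultimately show ?thesis
    by (metis mult_right_cancel)
qed

text \<open>The set of admissible \<open>d\<close> is closed under lcm, because an lcm of b-th
  powers is the b-th power of the lcm. So the lcm of any member with the maximum cannot exceed the
  maximum, which is therefore a multiple of every member.\<close>

lemma dvd_gen_gcd_iff:
  assumes "b \<ge> 1" "k \<ge> 1" "\<And>i. i < k \<Longrightarrow> n i > 0"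
  shows "e dvd gen_gcd b k n \<longleftrightarrow> (\<forall>i<k. e ^ b dvd n i)"
proof -
  let ?S = "{d. d \<ge> 1 \<and> (\<forall>i<k. d ^ b dvd n i)}"
  let ?g = "gen_gcd b k n"
  have fin: "finite ?S"
    using finite_gen_gcd_set[OF assms] by simp
  have "?g \<in> ?S"
    unfolding gen_gcd_def using gen_gcd_set_nonempty[OF assms] fin by (intro Max_in) auto
  then have g: "?g \<ge> 1" "\<And>i. i < k \<Longrightarrow> ?g ^ b dvd n i"
    by auto
  show ?thesis
  proof
    assume "e dvd ?g"
    then show "\<forall>i<k. e ^ b dvd n i"
      using g(2) by (meson dvd_power_same dvd_trans)
  next
    assume e: "\<forall>i<k. e ^ b dvd n i"
    have "n 0 > 0" "e ^ b dvd n 0"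
      using assms(2,3) e by auto
    then have "e > 0"
      using assms(1) by (cases "e = 0") (auto simp: zero_power)
    moreover have "lcm e ?g ^ b dvd n i" if "i < k" for i
      using that e g(2) by (metis lcm_least lcm_power_nat)
    ultimately have "lcm e ?g \<in> ?S"
      using g(1) by (auto simp: Suc_le_eq lcm_pos_nat)
    then have "lcm e ?g \<le> ?g"
      unfolding gen_gcd_def using fin by (intro Max_ge) auto
    moreover have "?g \<le> lcm e ?g"
      using \<open>e > 0\<close> g(1) by (intro dvd_imp_le) (auto intro: lcm_pos_nat)
    ultimately show "e dvd ?g"
      by (metis dvd_lcm1 le_antisym)
  qed
qed

section \<open>Counting tuples and the totient form of the sum\<close>

lemma card_multiples_le_real:
  fixes x :: real
  assumes "D > 0" "x \<ge> 0"
  shows "card {m :: nat. (1 \<le> m \<and> real m \<le> x) \<and> D dvd m} = nat \<lfloor>x / real D\<rfloor>"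
proof -
  have le_iff: "real (D * q) \<le> x \<longleftrightarrow> q \<le> nat \<lfloor>x / real D\<rfloor>" for q
    using assms by (simp add: nat_le_eq_zle le_nat_iff le_floor_iff le_divide_eq mult.commute)
  have "bij_betw (\<lambda>q. D * q) {1..nat \<lfloor>x / real D\<rfloor>} {m. (1 \<le> m \<and> real m \<le> x) \<and> D dvd m}"
    unfolding bij_betw_def
  proof
    show "inj_on (\<lambda>q. D * q) {1..nat \<lfloor>x / real D\<rfloor>}"
      using assms by (auto simp: inj_on_def)
    show "(\<lambda>q. D * q) ` {1..nat \<lfloor>x / real D\<rfloor>} = {m. (1 \<le> m \<and> real m \<le> x) \<and> D dvd m}"
    proof (intro set_eqI iffI)
      fix m assume "m \<in> (\<lambda>q. D * q) ` {1..nat \<lfloor>x / real D\<rfloor>}"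
      then show "m \<in> {m. (1 \<le> m \<and> real m \<le> x) \<and> D dvd m}"
        using le_iff assms by (auto simp: Suc_le_eq)
    next
      fix m assume "m \<in> {m. (1 \<le> m \<and> real m \<le> x) \<and> D dvd m}"
      then obtain q where "m = D * q" "1 \<le> D * q" "real (D * q) \<le> x"
        by auto
      then show "m \<in> (\<lambda>q. D * q) ` {1..nat \<lfloor>x / real D\<rfloor>}"
        using le_iff by (intro image_eqI[of _ _ q]) (auto simp: Suc_le_eq)
    qed
  qed
  from bij_betw_same_card[OF this] show ?thesis
    by simp
qed

lemma gcd_sum_real_eq:
  fixes x :: real
  assumes "b \<ge> 1" "k \<ge> 1" "x \<ge> 0"
  shows "gcd_sum real b k x =
    (\<Sum>e\<in>{1..nat \<lfloor>x\<rfloor>}. real (totient e) * real (nat \<lfloor>x / real e ^ b\<rfloor>) ^ k)"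
proof -
  let ?A = "{m :: nat. 1 \<le> m \<and> real m \<le> x}"
  let ?T = "{..<k} \<rightarrow>\<^sub>E ?A"
  let ?N = "nat \<lfloor>x\<rfloor>"
  have A: "?A = {1..?N}"
    using assms(3) by (auto simp: le_nat_floor le_nat_iff le_floor_iff)
  have fin: "finite ?T"
    unfolding A by (intro finite_PiE) auto
  \<comment> \<open>Every divisor satisfies \<open>e \<le> e ^ b \<le> n 0 \<le> ?N\<close>, so it
    lies in a range independent of \<open>n\<close>. This lets the two sums be swapped
    below.\<close>
  have gcd_expand: "gen_gcd b k n = (\<Sum>e | e \<in> {1..?N} \<and> (\<forall>i<k. e ^ b dvd n i). totient e)"
    if n: "n \<in> ?T" for n
  proof -
    have n_in: "n i \<in> {1..?N}" if "i < k" for i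
      using n that unfolding A by (auto simp: PiE_def Pi_def)
    have "{e. e dvd gen_gcd b k n} = {e \<in> {1..?N}. \<forall>i<k. e ^ b dvd n i}"
    proof -
      have "e \<in> {1..?N}" if "\<forall>i<k. e ^ b dvd n i" for e
      proof -
        have dvd: "e ^ b dvd n 0" and n0: "n 0 \<ge> 1" "n 0 \<le> ?N"
          using that assms(2) n_in[of 0] by auto
        from dvd n0 have "e \<noteq> 0"
          using assms(1) by (cases "e = 0") (auto simp: zero_power)
        moreover have "e \<le> e ^ b"
          using calculation assms(1) by (intro self_le_power) auto
        moreover have "e ^ b \<le> n 0"
          using dvd n0 by (intro dvd_imp_le) auto
        ultimately show ?thesis using n0 by auto
      qed
      moreover have "e dvd gen_gcd b k n \<longleftrightarrow> (\<forall>i<k. e ^ b dvd n i)" for e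
        using n_in assms by (intro dvd_gen_gcd_iff) (fastforce simp: Suc_le_eq)+
      ultimately show ?thesis by blast
    qed
    then show ?thesis
      using totient_divisor_sum[of "gen_gcd b k n"] by simp
  qed
  have count: "card {n \<in> ?T. \<forall>i<k. e ^ b dvd n i} = nat \<lfloor>x / real e ^ b\<rfloor> ^ k"
    if "e \<in> {1..?N}" for e
  proof -
    \<comment> \<open>The condition acts entrywise, so the tuples form a full function space and
      their number is a k-th power.\<close>
    have "{n \<in> ?T. \<forall>i<k. e ^ b dvd n i} = {..<k} \<rightarrow>\<^sub>E {m. (1 \<le> m \<and> real m \<le> x) \<and> e ^ b dvd m}"
      by (auto simp: PiE_def Pi_def)
    then show ?thesis
      using that assms(3) card_multiples_le_real[of "e ^ b" x] by (simp add: card_funcsetE)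
  qed
  have "gcd_sum real b k x =
      (\<Sum>n\<in>?T. \<Sum>e\<in>{1..?N}. if \<forall>i<k. e ^ b dvd n i then real (totient e) else 0)"
    unfolding gcd_sum_def
  proof (intro sum.cong refl)
    fix n assume "n \<in> ?T"
    then show "real (gen_gcd b k n) =
        (\<Sum>e\<in>{1..?N}. if \<forall>i<k. e ^ b dvd n i then real (totient e) else 0)"
      unfolding gcd_expand[OF \<open>n \<in> ?T\<close>] of_nat_sum
      by (intro sum.inter_filter) simp
  qed
  also have "\<dots> = (\<Sum>e\<in>{1..?N}. \<Sum>n\<in>?T. if \<forall>i<k. e ^ b dvd n i then real (totient e) else 0)"
    by (rule sum.swap)
  also have "\<dots> = (\<Sum>e\<in>{1..?N}. real (totient e) * real (nat \<lfloor>x / real e ^ b\<rfloor>) ^ k)"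
  proof (intro sum.cong refl)
    fix e assume e: "e \<in> {1..?N}"
    have "(\<Sum>n\<in>?T. if \<forall>i<k. e ^ b dvd n i then real (totient e) else 0) =
        (\<Sum>n | n \<in> ?T \<and> (\<forall>i<k. e ^ b dvd n i). real (totient e))"
      by (rule sum.inter_filter[OF fin, symmetric])
    also have "\<dots> = real (totient e) * real (nat \<lfloor>x / real e ^ b\<rfloor>) ^ k"
      using count[OF e] by simp
    finally show "(\<Sum>n\<in>?T. if \<forall>i<k. e ^ b dvd n i then real (totient e) else 0) =
        real (totient e) * real (nat \<lfloor>x / real e ^ b\<rfloor>) ^ k" .
  qed
  finally show ?thesis .
qed

section \<open>Zeta values and the Dirichlet series of the totient\<close>

lemma summable_inverse_powers:
  assumes "s \<ge> 2"
  shows "summable (\<lambda>n. 1 / real (Suc n) ^ s)"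
  using inverse_power_summable[OF assms, where ?'a = real]
  by (subst summable_Suc_iff) (simp add: inverse_eq_divide)

lemma zeta_of_nat: "zeta (real s) = (\<Sum>n. 1 / real (Suc n) ^ s)"
  unfolding zeta_def by (simp only: powr_realpow of_nat_0_less_iff zero_less_Suc)

lemma zeta_of_nat_pos: "s \<ge> 2 \<Longrightarrow> zeta (real s) > 0"
  unfolding zeta_of_nat by (intro suminf_pos summable_inverse_powers) auto

text \<open>Unordered sums allow the later regrouping by divisors. Nonnegativity makes convergence
  unconditional, and the shift by \<open>Suc\<close> matches the indexing of
  \<open>zeta\<close>.\<close>

lemma has_sum_pos_nat_iff_sums:
  fixes f :: "nat \<Rightarrow> real"
  assumes "\<And>n. f n \<ge> 0"
  shows "(f has_sum S) {0<..} \<longleftrightarrow> (\<lambda>n. f (Suc n)) sums S"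
proof -
  have "bij_betw Suc UNIV {0<..}"
    by (auto simp: bij_betw_def image_iff gr0_conv_Suc)
  then have "(f has_sum S) {0<..} \<longleftrightarrow> ((\<lambda>n. f (Suc n)) has_sum S) UNIV"
    by (rule has_sum_reindex_bij_betw[symmetric])
  then show ?thesis
    using has_sum_imp_sums sums_nonneg_imp_has_sum assms by blast
qed

text \<open>The bound \<phi>(e) \<le> e cancels one power of e; for e = 0 the left side is
  0.\<close>

lemma totient_term_le: "real (totient e) / real e ^ Suc s \<le> 1 / real e ^ s"
proof (cases "e = 0")
  case False
  have "real (totient e) / real e ^ Suc s \<le> real e / real e ^ Suc s"
    by (intro divide_right_mono) (auto simp: totient_le)
  also have "\<dots> = 1 / real e ^ s"
    using False by simp
  finally show ?thesis .
qed simp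

text \<open>Dirichlet convolution: summing \<phi> over divisors gives the identity, so the series
  times \<zeta>(s) is \<zeta>(s - 1). With s \<ge> 3 the comparison series has exponent s - 1 \<ge>
  2.\<close>

lemma totient_dirichlet_series:
  assumes "s \<ge> 3"
  shows "(\<lambda>n. real (totient (Suc n)) / real (Suc n) ^ s) sums (zeta (real (s - 1)) / zeta (real s))"
proof -
  let ?a = "\<lambda>e. real (totient e) / real e ^ s" and ?z = "\<lambda>m. 1 / real m ^ s"
  let ?A = "{0<..} :: nat set"
  obtain t where t: "s = Suc t" "t \<ge> 2"
    using assms by (cases s) auto
  have "summable (\<lambda>n. ?a (Suc n))"
  proof (rule summable_comparison_test'[OF summable_inverse_powers[OF t(2)], of 0])
    show "norm (?a (Suc n)) \<le> 1 / real (Suc n) ^ t" for n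
      using totient_term_le[of "Suc n" t] unfolding t(1) by simp
  qed
  then obtain P where P: "(\<lambda>n. ?a (Suc n)) sums P"
    by (auto simp: summable_def)
  have aP: "(?a has_sum P) ?A"
    using P by (subst has_sum_pos_nat_iff_sums) auto
  have zZ: "(?z has_sum zeta (real s)) ?A"
    using assms summable_sums[OF summable_inverse_powers[of s]]
    by (subst has_sum_pos_nat_iff_sums) (auto simp: zeta_of_nat)
  have prod: "((\<lambda>(e, m). ?a e * ?z m) has_sum (P * zeta (real s))) (?A \<times> ?A)"
  proof (rule has_sum_SigmaI)
    show row: "((\<lambda>m. case (e, m) of (e, m) \<Rightarrow> ?a e * ?z m) has_sum (?a e * zeta (real s))) ?A" for e
      using has_sum_cmult_right[OF zZ, of "?a e"] by simp
    show "((\<lambda>e. ?a e * zeta (real s)) has_sum (P * zeta (real s))) ?A"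
      using aP by (rule has_sum_cmult_left)
    then show "(\<lambda>(e, m). ?a e * ?z m) summable_on ?A \<times> ?A"
      by (intro summable_on_SigmaI[OF row]) (auto simp: summable_on_def)
  qed
  \<comment> \<open>Pairs \<open>(e, m)\<close> are regrouped by their product
    \<open>n = e * m\<close>, with \<open>e\<close> running over the divisors of
    \<open>n\<close>.\<close>
  have "((\<lambda>(e, m). ?a e * ?z m) has_sum (P * zeta (real s))) (?A \<times> ?A) \<longleftrightarrow>
      ((\<lambda>(n, e). real (totient e) / real n ^ s) has_sum (P * zeta (real s)))
        (SIGMA n:?A. {e. e dvd n})"
    by (intro has_sum_reindex_bij_witness[where j = "\<lambda>(e, m). (e * m, e)"
          and i = "\<lambda>(n, e). (e, n div e)"])
      (auto simp: power_mult_distrib elim!: dvdE intro: dvd_pos_nat)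
  with prod have pairs: "((\<lambda>(n, e). real (totient e) / real n ^ s) has_sum (P * zeta (real s)))
      (SIGMA n:?A. {e. e dvd n})"
    by simp
  have "((\<lambda>n. \<Sum>e | e dvd n. real (totient e) / real n ^ s) has_sum (P * zeta (real s))) ?A"
    by (rule has_sum_SigmaD[OF pairs]) (simp add: has_sum_finite)
  also have "?this \<longleftrightarrow> ((\<lambda>n. 1 / real n ^ t) has_sum (P * zeta (real s))) ?A"
  proof (intro has_sum_cong)
    fix n :: nat assume "n \<in> ?A"
    then have n: "n > 0" by simp
    have "(\<Sum>e | e dvd n. real (totient e) / real n ^ s) = real n / real n ^ s"
      unfolding sum_divide_distrib[symmetric] of_nat_sum[symmetric] totient_divisor_sum ..
    then show "(\<Sum>e | e dvd n. real (totient e) / real n ^ s) = 1 / real n ^ t"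
      using n t(1) by simp
  qed
  also have "\<dots> \<longleftrightarrow> (\<lambda>n. 1 / real (Suc n) ^ t) sums (P * zeta (real s))"
    by (rule has_sum_pos_nat_iff_sums) simp
  finally have "P * zeta (real s) = zeta (real t)"
    unfolding zeta_of_nat by (rule sums_unique)
  \<comment> \<open>Division is legitimate because \<open>zeta (real s)\<close> is positive.\<close>
  then have "P = zeta (real (s - 1)) / zeta (real s)"
    using zeta_of_nat_pos[of s] assms t(1) by (simp add: field_simps)
  with P show ?thesis by simp
qed

section \<open>Explicit error bound: floors and tail\<close>

lemma power_Suc_diff_le:
  fixes q y :: real
  assumes "0 \<le> q" "q \<le> y" "y \<le> q + 1"
  shows "y ^ Suc k - q ^ Suc k \<le> real (Suc k) * y ^ k"
proof (induction k)
  case 0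
  then show ?case using assms by simp
next
  case (Suc k)
  \<comment> \<open>Since \<open>y - q \<le> 1\<close> and \<open>q \<le> y\<close>, the last
    summand adds just one more \<open>y ^ Suc k\<close> to the bound.\<close>
  have "y ^ Suc (Suc k) - q ^ Suc (Suc k) = y * (y ^ Suc k - q ^ Suc k) + (y - q) * q ^ Suc k"
    by (simp add: algebra_simps)
  also have "\<dots> \<le> y * (real (Suc k) * y ^ k) + 1 * y ^ Suc k"
    using assms by (intro add_mono mult_left_mono mult_mono power_mono Suc.IH) auto
  also have "\<dots> = real (Suc (Suc k)) * y ^ Suc k"
    by (simp add: algebra_simps)
  finally show ?case .
qed

text \<open>The first error term pays for the floors, the second for the tail of the series. The
  exponent \<open>b * (k - 1) - 1\<close> separates the two cases of the theorem: it is 1 for b = k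
  = 2 and at least 2 once b \<ge> 3.\<close>

lemma gcd_sum_real_error:
  assumes "b \<ge> 2" "k \<ge> 2" "x \<ge> 1"
  shows "\<bar>gcd_sum real b k x - zeta (real (b * k) - 1) / zeta (real (b * k)) * x ^ k\<bar> \<le>
    real k * x ^ (k - 1) * (\<Sum>e\<in>{1..nat \<lfloor>x\<rfloor>}. 1 / real e ^ (b * (k - 1) - 1))
    + 2 * zeta 2 * x ^ (k - 1)"
proof -
  define N where "N = nat \<lfloor>x\<rfloor>"
  define s where "s = b * k"
  define t where "t = b * (k - 1) - 1"
  obtain l where l: "k = Suc l" "l \<ge> 1"
    using assms(2) by (cases k) auto
  have s4: "s \<ge> 4"
    using mult_le_mono[OF assms(1,2)] by (simp add: s_def)
  \<comment> \<open>This puts the exponent into the shape \<open>Suc t\<close> required by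
    \<open>totient_term_le\<close>.\<close>
  have t_eq: "b * l = Suc t"
    using assms(1) l by (cases b; cases l) (auto simp: t_def)
  have N: "N \<ge> 1" "real N \<le> x" "x \<le> 2 * real N"
  proof -
    show N1: "N \<ge> 1" and "real N \<le> x"
      using assms(3) unfolding N_def by linarith+
    have "x \<le> real N + 1"
      using assms(3) unfolding N_def by linarith
    then show "x \<le> 2 * real N"
      using N1 by linarith
  qed
  define a where "a = (\<lambda>e. real (totient e) / real e ^ s)"
  define c where "c = zeta (real s - 1) / zeta (real s)"
  have a_sums: "(\<lambda>n. a (Suc n)) sums c"
    using totient_dirichlet_series[of s] s4 by (simp add: a_def c_def of_nat_diff)
  define R where "R = (\<Sum>n. a (Suc (n + N)))"
  have c_split: "c = (\<Sum>e\<in>{1..N}. a e) + R"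
  proof -
    have "c = (\<Sum>n. a (Suc n))"
      using a_sums by (rule sums_unique)
    also have "\<dots> = R + (\<Sum>n<N. a (Suc n))"
      unfolding R_def using a_sums by (intro suminf_split_initial_segment) (rule sums_summable)
    also have "(\<Sum>n<N. a (Suc n)) = (\<Sum>e\<in>{1..N}. a e)"
      by (simp add: sum.atLeast1_atMost_eq)
    finally show ?thesis by simp
  qed
  have R_nonneg: "R \<ge> 0"
    unfolding R_def using a_sums
    by (intro suminf_nonneg summable_ignore_initial_segment[of "\<lambda>n. a (Suc n)"])
      (auto simp: a_def sums_iff)
  have R_le: "R \<le> zeta 2 / real N"
  proof -
    \<comment> \<open>As s \<ge> 4, the term is at most the inverse cube of
      \<open>Suc (n + N)\<close>. Two factors are bounded below by \<open>Suc n\<close>, for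
      convergence, and one by \<open>N\<close>, for decay.\<close>
    have tail_term: "a (Suc (n + N)) \<le> 1 / real (Suc n) ^ 2 / real N" for n
    proof -
      let ?e = "Suc (n + N)"
      have r: "s = Suc ((s - 4) + 3)"
        using s4 by simp
      have "a ?e \<le> 1 / real ?e ^ ((s - 4) + 3)"
        unfolding a_def by (subst r) (rule totient_term_le)
      also have "\<dots> \<le> 1 / real ?e ^ 3"
        by (intro divide_left_mono power_increasing mult_pos_pos) auto
      also have "\<dots> = 1 / (real ?e ^ 2 * real ?e)"
        by (simp add: eval_nat_numeral)
      also have "\<dots> \<le> 1 / (real (Suc n) ^ 2 * real N)"
        using N(1) by (intro divide_left_mono mult_mono power_mono mult_pos_pos) auto
      finally show ?thesis by simp
    qed
    have "R \<le> (\<Sum>n. 1 / real (Suc n) ^ 2 / real N)"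
      unfolding R_def
    proof (rule suminf_le[OF tail_term])
      show "summable (\<lambda>n. a (Suc (n + N)))"
        using a_sums by (intro summable_ignore_initial_segment[of "\<lambda>n. a (Suc n)"])
          (auto simp: sums_iff)
      show "summable (\<lambda>n. 1 / real (Suc n) ^ 2 / real N)"
        by (intro summable_divide summable_inverse_powers) simp
    qed
    also have "\<dots> = zeta 2 / real N"
      using suminf_divide[OF summable_inverse_powers[of 2], of "real N"] zeta_of_nat[of 2] by simp
    finally show ?thesis .
  qed
  define F where "F = (\<lambda>e. real (nat \<lfloor>x / real e ^ b\<rfloor>))"
  have S: "gcd_sum real b k x = (\<Sum>e\<in>{1..N}. real (totient e) * F e ^ k)"
    unfolding N_def F_def using assms by (intro gcd_sum_real_eq) auto
  have term_le: "\<bar>real (totient e) * F e ^ k - a e * x ^ k\<bar> \<le> real k * x ^ l * (1 / real e ^ t)"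
    for e
  proof -
    define y where "y = x / real e ^ b"
    have F: "0 \<le> F e" "F e \<le> y" "y \<le> F e + 1"
      using assms(3) unfolding F_def y_def by (auto simp: of_nat_floor)
    have "F e ^ k \<le> y ^ k"
      using F by (intro power_mono)
    moreover have "y ^ k - F e ^ k \<le> real k * y ^ l"
      unfolding l(1) using F by (rule power_Suc_diff_le)
    ultimately have diff: "\<bar>F e ^ k - y ^ k\<bar> \<le> real k * y ^ l"
      by linarith
    \<comment> \<open>The exponent \<open>s = b * k\<close> makes the main term the same expression
      with the floor removed.\<close>
    have "a e * x ^ k = real (totient e) * y ^ k"
      by (simp add: a_def y_def s_def power_divide power_mult)
    then have "\<bar>real (totient e) * F e ^ k - a e * x ^ k\<bar> = real (totient e) * \<bar>F e ^ k - y ^ k\<bar>"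
      by (simp add: abs_mult flip: right_diff_distrib)
    also have "\<dots> \<le> real (totient e) * (real k * y ^ l)"
      using diff by (intro mult_left_mono) auto
    also have "\<dots> = real k * x ^ l * (real (totient e) / real e ^ Suc t)"
      unfolding t_eq[symmetric] by (simp add: y_def power_divide power_mult)
    also have "\<dots> \<le> real k * x ^ l * (1 / real e ^ t)"
      using assms(3) by (intro mult_left_mono totient_term_le) auto
    finally show ?thesis .
  qed
  \<comment> \<open>The finite part of the series is matched term by term, leaving only the tail
    \<open>R\<close>.\<close>
  have "gcd_sum real b k x - c * x ^ k =
      (\<Sum>e\<in>{1..N}. real (totient e) * F e ^ k - a e * x ^ k) - R * x ^ k"
    by (simp add: S c_split sum_subtractf distrib_right flip: sum_distrib_right)
  also have "\<bar>\<dots>\<bar> \<le> (\<Sum>e\<in>{1..N}. \<bar>real (totient e) * F e ^ k - a e * x ^ k\<bar>) + \<bar>R * x ^ k\<bar>"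
    by (intro order_trans[OF abs_triangle_ineq4] add_mono sum_abs) auto
  also have "\<dots> \<le> (\<Sum>e\<in>{1..N}. real k * x ^ l * (1 / real e ^ t)) + 2 * zeta 2 * x ^ l"
  proof (intro add_mono sum_mono term_le)
    \<comment> \<open>One factor \<open>x \<le> 2 * real N\<close> is absorbed by
      \<open>R \<le> zeta 2 / real N\<close>, whence the constant \<open>2 * zeta 2\<close>.\<close>
    have "\<bar>R * x ^ k\<bar> = R * x * x ^ l"
      using R_nonneg assms(3) l(1) by (simp add: abs_mult)
    also have "\<dots> \<le> (zeta 2 / real N) * (2 * real N) * x ^ l"
      using R_le R_nonneg N assms(3) zeta_of_nat_pos[of 2]
      by (intro mult_right_mono mult_mono) auto
    also have "\<dots> = 2 * zeta 2 * x ^ l"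
      using N(1) by simp
    finally show "\<bar>R * x ^ k\<bar> \<le> 2 * zeta 2 * x ^ l" .
  qed
  also have "(\<Sum>e\<in>{1..N}. real k * x ^ l * (1 / real e ^ t)) =
      real k * x ^ l * (\<Sum>e\<in>{1..N}. 1 / real e ^ t)"
    by (rule sum_distrib_left[symmetric])
  finally show ?thesis
    unfolding c_def s_def N_def t_def using l(1) by simp
qed

section \<open>Sums of inverse powers and the asymptotics\<close>

lemma harm_le_ln_plus_1:
  assumes "n \<ge> 1"
  shows "harm n \<le> ln (real n) + 1"
  \<comment> \<open>The decreasing sequence is indexed from \<open>Suc 0\<close>, so index
    \<open>n - 1\<close> refers to \<open>n\<close>, and its value at index 0 is 1.\<close>
  using decseqD[OF decseq_harm_diff_ln, of 0 "n - 1"] assms by (simp add: harm_expand)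

lemma sum_inverse_powers_le_zeta:
  assumes "t \<ge> 2"
  shows "(\<Sum>e\<in>{1..N}. 1 / real e ^ t) \<le> zeta 2"
proof -
  have "(\<Sum>e\<in>{1..N}. 1 / real e ^ t) \<le> (\<Sum>e\<in>{1..N}. 1 / real e ^ 2)"
    using assms by (intro sum_mono divide_left_mono power_increasing mult_pos_pos) auto
  also have "\<dots> = (\<Sum>n<N. 1 / real (Suc n) ^ 2)"
    by (simp add: sum.atLeast1_atMost_eq)
  also have "\<dots> \<le> zeta 2"
    using zeta_of_nat[of 2] sum_le_suminf[OF summable_inverse_powers[of 2], of "{..<N}"] by simp
  finally show ?thesis .
qed

theorem theorem1p6:
  shows "(\<lambda>x :: real. gcd_sum real 2 2 x - zeta 3 / zeta 4 * x ^ 2) \<in> O[at_top](\<lambda>x. x * ln x)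
    \<and> (\<forall>b k :: nat. b \<ge> 3 \<longrightarrow> k \<ge> 2 \<longrightarrow>
      (\<lambda>x :: real. gcd_sum real b k x
          - zeta (real (b * k) - 1) / zeta (real (b * k)) * x ^ k)
        \<in> O[at_top](\<lambda>x. x ^ (k - 1)))"
proof (intro conjI allI impI)
  show "(\<lambda>x :: real. gcd_sum real 2 2 x - zeta 3 / zeta 4 * x ^ 2) \<in> O[at_top](\<lambda>x. x * ln x)"
  proof (rule bigoI[of _ "4 + 2 * zeta 2"])
    show "\<forall>\<^sub>F x in at_top. norm (gcd_sum real 2 2 x - zeta 3 / zeta 4 * x ^ 2) \<le>
        (4 + 2 * zeta 2) * norm (x * ln x)"
      \<comment> \<open>From e onwards ln x \<ge> 1, so both ln x + 1 \<le> 2 ln x and x \<le> x ln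
        x hold. The floors then contribute 4 to the constant and the tail
        \<open>2 * zeta 2\<close>.\<close>
      using eventually_ge_at_top[of "exp 1"]
    proof eventually_elim
      case (elim x)
      have x: "x \<ge> 1" "ln x \<ge> 1"
        using elim one_le_exp_iff[of 1] ln_ge_iff[of x 1] by (smt (verit))+
      define N where "N = nat \<lfloor>x\<rfloor>"
      have N: "N \<ge> 1" "real N \<le> x"
        using x(1) unfolding N_def by linarith+
      have "(\<Sum>e\<in>{1..N}. 1 / real e) = harm N"
        by (simp add: harm_def inverse_eq_divide)
      also have "\<dots> \<le> ln x + 1"
        using harm_le_ln_plus_1[OF N(1)] N x by (smt (verit) ln_le_cancel_iff of_nat_1 of_nat_mono)
      also have "\<dots> \<le> 2 * ln x"
        using x by simp
      finally have sum_le: "(\<Sum>e\<in>{1..N}. 1 / real e) \<le> 2 * ln x" .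
      \<comment> \<open>Here the exponent in the error sum is 1, so the sum is harmonic; this is the
        source of the logarithm.\<close>
      have "\<bar>gcd_sum real 2 2 x - zeta 3 / zeta 4 * x ^ 2\<bar> \<le>
          2 * x * (\<Sum>e\<in>{1..N}. 1 / real e) + 2 * zeta 2 * x"
        using gcd_sum_real_error[of 2 2 x] x(1) by (simp add: N_def)
      also have "\<dots> \<le> 2 * x * (2 * ln x) + 2 * zeta 2 * (x * ln x)"
        using sum_le x zeta_of_nat_pos[of 2] by (intro add_mono mult_left_mono) auto
      also have "\<dots> = (4 + 2 * zeta 2) * norm (x * ln x)"
        using x by (simp add: algebra_simps)
      finally show ?case by simp
    qed
  qed
next
  fix b k :: nat
  assume b: "b \<ge> 3" and k: "k \<ge> 2"
  show "(\<lambda>x :: real. gcd_sum real b k x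
      - zeta (real (b * k) - 1) / zeta (real (b * k)) * x ^ k) \<in> O[at_top](\<lambda>x. x ^ (k - 1))"
  proof (rule bigoI[of _ "real k * zeta 2 + 2 * zeta 2"])
    show "\<forall>\<^sub>F x in at_top. norm (gcd_sum real b k x
        - zeta (real (b * k) - 1) / zeta (real (b * k)) * x ^ k) \<le>
        (real k * zeta 2 + 2 * zeta 2) * norm (x ^ (k - 1))"
      using eventually_ge_at_top[of 1]
    proof eventually_elim
      case (elim x)
      \<comment> \<open>The exponent is now at least 2, so the error sum stays below
        \<open>zeta 2\<close> for all x and no logarithm arises.\<close>
      have "3 * 1 \<le> b * (k - 1)"
        using b k by (intro mult_le_mono) auto
      then have t: "b * (k - 1) - 1 \<ge> 2"
        by linarith
      have "\<bar>gcd_sum real b k x - zeta (real (b * k) - 1) / zeta (real (b * k)) * x ^ k\<bar> \<le>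
          real k * x ^ (k - 1) * (\<Sum>e\<in>{1..nat \<lfloor>x\<rfloor>}. 1 / real e ^ (b * (k - 1) - 1))
          + 2 * zeta 2 * x ^ (k - 1)"
        using b k elim by (intro gcd_sum_real_error) auto
      also have "\<dots> \<le> real k * x ^ (k - 1) * zeta 2 + 2 * zeta 2 * x ^ (k - 1)"
        using elim by (intro add_right_mono mult_left_mono sum_inverse_powers_le_zeta[OF t]) simp_all
      also have "\<dots> = (real k * zeta 2 + 2 * zeta 2) * norm (x ^ (k - 1))"
        using elim by (simp add: algebra_simps)
      finally show ?case by simp
    qed
  qed
qed

end
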